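(* Let $R$ be a reduced commutative ring with identity having exactly $n$ minimal prime ideals, where $3\le n<\infty$, and assume $\alpha_{\max}\ge 2$. Then for every $i\in S$, the set $Z(R)^*\setminus\gamma_i$ is a minimum cut-set of $W\Gamma(R)$. If moreover $R$ is finite, then $$\kappa(W\Gamma(R))=|Z(R)^*|-\alpha_{\max}=\delta(W\Gamma(R)).$$
   Context: Weakly zero-divisor graph: for a commutative ring $R$ with identity, $Z(R)$ is the set of zero-divisors (elements $x$ with $xy=0$ for some $y\ne 0$), $Z(R)^*=Z(R)\setminus\{0\}$, and $\mathrm{ann}(x)=\{r\in R: rx=0\}$. $W\Gamma(R)$ is the simple undirected graph with vertex set $Z(R)^*$ in which two distinct vertices $x,y$ are adjacent if and only if there exist nonzero $w\in\mathrm{ann}(x)$ and nonzero $z\in\mathrm{ann}(y)$ with $wz=0$. Minimal primes: $\mathrm{Min}(R)=\{\mathfrak p_1,\dots,\mathfrak p_n\}$ is the set of minimal prime ideals of $R$. For $1\le i\le n$, $\gamma_i:=\mathfrak p_i\setminus\bigcup_{j\ne i}\mathfrak p_j$; $\alpha_{\max}:=\max\{|\gamma_i|:1\le i\le n\}$; and $S:=\{j:|\gamma_j|=\alpha_{\max}\}$. Graph notions: a cut-set of a connected graph $\Gamma$ is a set $A\subseteq V(\Gamma)$ such that there are distinct vertices $x,y\in V(\Gamma)\setminus A$ with every path from $x$ to $y$ meeting $A$, and no proper subset of $A$ has this property. A cut-set $A$ is minimum if $|A|\le|B|$ for every cut-set $B$. $\kappa(\Gamma)$ (vertex connectivity) is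 the cardinality of a minimum cut-set. $\deg(v)$ is the cardinality of the set of neighbours of $v$, and $\delta(\Gamma)=\min\{\deg(v): v\in V(\Gamma)\}$. *)

theory Defs
  imports "HOL-Algebra.Ideal" "Graph_Theory.Graph_Theory"
begin

unbundle cardinal_syntax

section \<open>Cardinals\<close>

text \<open>The rings may be infinite, and sizes of sets are then compared as genuine cardinals (two
  infinite sets need not have the same size).  A cardinal is represented, as in HOL's theory of
  cardinals, by a minimal well-order \<open>|X|\<close>, and equality of cardinals is \<open>=o\<close>.

  The following are the largest and smallest cardinality of a member of a family of sets, determined
  up to \<open>=o\<close>.  The largest one exists for nonempty finite families, the smallest one for all
  nonempty families.\<close>

definition max_cardinal :: "'a set set \<Rightarrow> 'a rel" where
  "max_cardinal F = (SOME r. \<exists>X\<in>F. r = |X| \<and> (\<forall>Y\<in>F. |Y| \<le>o |X| ))"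

definition min_cardinal :: "'a set set \<Rightarrow> 'a rel" where
  "min_cardinal F = (SOME r. \<exists>X\<in>F. r = |X| \<and> (\<forall>Y\<in>F. |X| \<le>o |Y| ))"

text \<open>The natural number denoted by a finite cardinal.\<close>

definition nat_of_cardinal :: "'a rel \<Rightarrow> nat" where
  "nat_of_cardinal r = card (Field r)"

lemma nat_of_cardinal_card_of [simp]: "nat_of_cardinal |X| = card X"
  by (simp add: nat_of_cardinal_def Field_card_of)

lemma finite_card_of_ordLeq:
  assumes "finite X" "finite Y"
  shows "|X| \<le>o |Y| \<longleftrightarrow> card X \<le> card Y"
  using card_of_ordLeq[of X Y] inj_on_iff_card_le[OF assms] by simp

lemma nat_of_max_cardinal:
  assumes "finite F" "F \<noteq> {}" "\<And>X. X \<in> F \<Longrightarrow> finite X"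
  shows "nat_of_cardinal (max_cardinal F) = Max (card ` F)"
proof -
  have "Max (card ` F) \<in> card ` F" using assms by (intro Max_in) auto
  then obtain X where X: "X \<in> F" "Max (card ` F) = card X" by blast
  have "|Y| \<le>o |X|" if "Y \<in> F" for Y
  proof -
    have "card Y \<le> card X" using X(2)[symmetric] assms(1) that by simp
    then show ?thesis
      using assms(3) X(1) that by (simp add: finite_card_of_ordLeq)
  qed
  then have "\<exists>r. \<exists>X\<in>F. r = |X| \<and> (\<forall>Y\<in>F. |Y| \<le>o |X| )" using X(1) by blast
  from someI_ex[OF this] obtain Z where
    Z: "Z \<in> F" "max_cardinal F = |Z|" "\<forall>Y\<in>F. |Y| \<le>o |Z|"
    unfolding max_cardinal_def by blast
  have "card Y \<le> card Z" if "Y \<in> F" for Y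
    using Z(1) bspec[OF Z(3) that] that assms(3) by (simp add: finite_card_of_ordLeq)
  then have "Max (card ` F) = card Z" using Z(1) assms(1) by (intro Max_eqI) auto
  then show ?thesis using Z(2) by simp
qed

lemma nat_of_min_cardinal:
  assumes "finite F" "F \<noteq> {}" "\<And>X. X \<in> F \<Longrightarrow> finite X"
  shows "nat_of_cardinal (min_cardinal F) = Min (card ` F)"
proof -
  have "Min (card ` F) \<in> card ` F" using assms by (intro Min_in) auto
  then obtain X where X: "X \<in> F" "Min (card ` F) = card X" by blast
  have "|X| \<le>o |Y|" if "Y \<in> F" for Y
  proof -
    have "card X \<le> card Y" using X(2)[symmetric] assms(1) that by simp
    then show ?thesis
      using assms(3) X(1) that by (simp add: finite_card_of_ordLeq)
  qed
  then have "\<exists>r. \<exists>X\<in>F. r = |X| \<and> (\<forall>Y\<in>F. |X| \<le>o |Y| )" using X(1) by blast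
  from someI_ex[OF this] obtain Z where
    Z: "Z \<in> F" "min_cardinal F = |Z|" "\<forall>Y\<in>F. |Z| \<le>o |Y|"
    unfolding min_cardinal_def by blast
  have "card Z \<le> card Y" if "Y \<in> F" for Y
    using Z(1) bspec[OF Z(3) that] that assms(3) by (simp add: finite_card_of_ordLeq)
  then have "Min (card ` F) = card Z" using Z(1) assms(1) by (intro Min_eqI) auto
  then show ?thesis using Z(2) by simp
qed

section \<open>Graphs\<close>

text \<open>Simple undirected graphs are represented as symmetric loop-free digraphs without parallel
  arcs; an edge is the pair of its two opposite arcs.\<close>

definition separates :: "'a pair_pre_digraph \<Rightarrow> 'a set \<Rightarrow> bool" where
  "separates G A \<longleftrightarrow> (\<exists>x\<in>pverts G - A. \<exists>y\<in>pverts G - A. x \<noteq> y \<and>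
     (\<forall>q. vpath q (with_proj G) \<and> hd q = x \<and> last q = y \<longrightarrow> set q \<inter> A \<noteq> {}))"

definition cut_set :: "'a pair_pre_digraph \<Rightarrow> 'a set \<Rightarrow> bool" where
  "cut_set G A \<longleftrightarrow> Digraph_Component.connected (with_proj G) \<and> A \<subseteq> pverts G \<and>
     separates G A \<and> (\<forall>B. B \<subset> A \<longrightarrow> \<not> separates G B)"

definition minimum_cut_set :: "'a pair_pre_digraph \<Rightarrow> 'a set \<Rightarrow> bool" where
  "minimum_cut_set G A \<longleftrightarrow> cut_set G A \<and> (\<forall>B. cut_set G B \<longrightarrow> |A| \<le>o |B| )"

definition vertex_connectivity :: "'a pair_pre_digraph \<Rightarrow> 'a rel" where
  "vertex_connectivity G = |SOME A. minimum_cut_set G A|"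

definition neighbours :: "'a pair_pre_digraph \<Rightarrow> 'a \<Rightarrow> 'a set" where
  "neighbours G v = {u \<in> pverts G. (v, u) \<in> parcs G}"

definition min_degree :: "'a pair_pre_digraph \<Rightarrow> 'a rel" where
  "min_degree G = min_cardinal (neighbours G ` pverts G)"

section \<open>Commutative rings\<close>

definition reduced :: "('a, 'b) ring_scheme \<Rightarrow> bool" where
  "reduced R \<longleftrightarrow> (\<forall>x\<in>carrier R. \<forall>k::nat. x [^]\<^bsub>R\<^esub> k = \<zero>\<^bsub>R\<^esub> \<longrightarrow> x = \<zero>\<^bsub>R\<^esub>)"

definition zero_divisors :: "('a, 'b) ring_scheme \<Rightarrow> 'a set" where
  "zero_divisors R = {x \<in> carrier R. \<exists>y\<in>carrier R. y \<noteq> \<zero>\<^bsub>R\<^esub> \<and> x \<otimes>\<^bsub>R\<^esub> y = \<zero>\<^bsub>R\<^esub>}"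

definition nonzero_zero_divisors :: "('a, 'b) ring_scheme \<Rightarrow> 'a set" where
  "nonzero_zero_divisors R = zero_divisors R - {\<zero>\<^bsub>R\<^esub>}"

definition ann :: "('a, 'b) ring_scheme \<Rightarrow> 'a \<Rightarrow> 'a set" where
  "ann R x = {r \<in> carrier R. r \<otimes>\<^bsub>R\<^esub> x = \<zero>\<^bsub>R\<^esub>}"

definition WGamma :: "('a, 'b) ring_scheme \<Rightarrow> 'a pair_pre_digraph" where
  "WGamma R = \<lparr> pverts = nonzero_zero_divisors R,
     parcs = {(x, y). x \<in> nonzero_zero_divisors R \<and> y \<in> nonzero_zero_divisors R \<and> x \<noteq> y \<and>
       (\<exists>w\<in>ann R x - {\<zero>\<^bsub>R\<^esub>}. \<exists>z\<in>ann R y - {\<zero>\<^bsub>R\<^esub>}. w \<otimes>\<^bsub>R\<^esub> z = \<zero>\<^bsub>R\<^esub>)} \<rparr>"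

lemma WGamma_bidirected:
  assumes "cring R"
  shows "pair_bidirected_digraph (WGamma R)"
proof -
  interpret cring R by fact
  have "(y, x) \<in> parcs (WGamma R)" if "(x, y) \<in> parcs (WGamma R)" for x y
  proof -
    from that obtain w z where "x \<in> nonzero_zero_divisors R" "y \<in> nonzero_zero_divisors R"
      "x \<noteq> y" and wz: "w \<in> ann R x - {\<zero>\<^bsub>R\<^esub>}" "z \<in> ann R y - {\<zero>\<^bsub>R\<^esub>}" "w \<otimes>\<^bsub>R\<^esub> z = \<zero>\<^bsub>R\<^esub>"
      unfolding WGamma_def pair_pre_digraph.simps mem_Collect_eq case_prod_conv by blast
    moreover from wz have "z \<otimes>\<^bsub>R\<^esub> w = \<zero>\<^bsub>R\<^esub>" using m_comm[of z w] by (simp add: ann_def)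
    ultimately show ?thesis
      unfolding WGamma_def pair_pre_digraph.simps mem_Collect_eq case_prod_conv by blast
  qed
  then have "symmetric (with_proj (WGamma R))"
    by (simp add: symmetric_def sym_def)
  moreover have "fst e \<in> pverts (WGamma R) \<and> snd e \<in> pverts (WGamma R) \<and> fst e \<noteq> snd e"
    if "e \<in> parcs (WGamma R)" for e
    using that by (auto simp: WGamma_def)
  ultimately show ?thesis
    by (intro pair_bidirected_digraph.intro pair_sym_digraph.intro pair_sym_digraph_axioms.intro
        pair_loopfree_digraph.intro pair_loopfree_digraph_axioms.intro pair_wf_digraph.intro) blast+
qed

definition minimal_primes :: "('a, 'b) ring_scheme \<Rightarrow> 'a set set" where
  "minimal_primes R = {P. primeideal P R \<and> (\<forall>Q. primeideal Q R \<and> Q \<subseteq> P \<longrightarrow> Q = P)}"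

text \<open>In the following, \<open>p 1, \<dots>, p n\<close> is an enumeration of the minimal primes.\<close>

definition gamma :: "(nat \<Rightarrow> 'a set) \<Rightarrow> nat \<Rightarrow> nat \<Rightarrow> 'a set" where
  "gamma p n i = p i - (\<Union>j\<in>{1..n} - {i}. p j)"

definition alpha_max :: "(nat \<Rightarrow> 'a set) \<Rightarrow> nat \<Rightarrow> 'a rel" where
  "alpha_max p n = max_cardinal (gamma p n ` {1..n})"

definition alpha_indices :: "(nat \<Rightarrow> 'a set) \<Rightarrow> nat \<Rightarrow> nat set" where
  "alpha_indices p n = {j \<in> {1..n}. |gamma p n j| =o alpha_max p n}"

end

theory Submission
  imports Defs
begin

text \<open>
  Let \<open>p 1, \<dots>, p n\<close> be the minimal primes of the reduced ring \<open>R\<close>.  Their union is the set of zero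
  divisors and their intersection is zero (\<open>zero_divisor_iff\<close>, \<open>in_all_minimal_primes_iff\<close>), so
  whether a product vanishes can be read off from the minimal primes that contain the factors.  For
  each \<open>i\<close> there is an element \<open>e\<^sub>i\<close> that lies in every \<open>p j\<close> with \<open>j \<noteq> i\<close> but not in
  \<open>p i\<close> (\<open>ex_outside_exactly_one\<close>).  It annihilates every element of \<open>p i\<close>, and
  \<open>e\<^sub>i e\<^sub>j = 0\<close> for \<open>i \<noteq> j\<close>.  Hence two vertices \<open>x \<in> p i\<close> and \<open>y \<in> p j\<close> with \<open>i \<noteq> j\<close> are adjacent.
  The only way to avoid this is that \<open>x\<close> and \<open>y\<close> lie in one and the same minimal prime \<open>p i\<close> and in
  no other one; then nonzero annihilators of \<open>x\<close> and of \<open>y\<close> lie outside the prime \<open>p i\<close>, and so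
  does their product.  So two distinct vertices are non-adjacent precisely if they lie in the same
  \<open>\<gamma>\<^sub>i\<close> (\<open>WGamma_adjacent_iff\<close>), and the sets \<open>\<gamma>\<^sub>i\<close> are nonempty and disjoint.

  The rest is graph theory: \<open>W\<Gamma>(R)\<close> is the join of a complete multipartite graph, with parts
  \<open>\<gamma>\<^sub>i\<close>, and a complete graph.  In such a graph, two vertices that a set \<open>A\<close> separates lie in one
  part \<open>\<gamma>\<^sub>i\<close>, and then \<open>A\<close> contains all their common neighbours, that is, the complement of
  \<open>\<gamma>\<^sub>i\<close>.  Therefore the cut-sets are the complements of the parts with at least two elements
  (\<open>cut_set_iff\<close>), and those of least size are the complements of the largest parts.  The
  neighbourhood of a vertex of \<open>\<gamma>\<^sub>i\<close> is this same complement, and a vertex outside all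
  \<open>\<gamma>\<^sub>i\<close> is adjacent to all other vertices, so for finite \<open>R\<close> the minimum degree has the same
  value.
\<close>

section \<open>Cardinals\<close>

lemma max_cardinal_attained:
  fixes F :: "'a set set"
  assumes "finite F" "F \<noteq> {}"
  obtains X where "X \<in> F" "max_cardinal F = |X|" "\<And>Y. Y \<in> F \<Longrightarrow> |Y| \<le>o |X|"
proof -
  have "\<exists>X\<in>F. \<forall>Y\<in>F. |Y| \<le>o |X|"
    using assms
  proof (induction F rule: finite_ne_induct)
    case (singleton A)
    show ?case by (simp add: card_of_mono1)
  next
    case (insert A F)
    then obtain X where X: "X \<in> F" "\<forall>Y\<in>F. |Y| \<le>o |X|" by blast
    consider "|A| \<le>o |X|" | "|X| \<le>o |A|"
      using ordLeq_total[OF card_of_Well_order card_of_Well_order] by blast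
    then show ?case
    proof cases
      case 1
      then show ?thesis using X by blast
    next
      case 2
      have "|Y| \<le>o |A|" if "Y \<in> insert A F" for Y
        using that X(2) 2 by (auto intro: ordLeq_transitive card_of_mono1)
      then show ?thesis by blast
    qed
  qed
  then have "\<exists>r. \<exists>X\<in>F. r = |X| \<and> (\<forall>Y\<in>F. |Y| \<le>o |X| )" by blast
  from someI_ex[OF this] show thesis
    unfolding max_cardinal_def[symmetric] using that by blast
qed

lemma ctwo_ordLeqE:
  assumes "ctwo \<le>o |X|"
  obtains x y where "x \<in> X" "y \<in> X" "x \<noteq> y"
proof -
  from assms obtain f :: "bool \<Rightarrow> 'a" where "inj f" "range f \<subseteq> X"
    unfolding ctwo_def card_of_ordLeq[symmetric] by blast
  then have "f True \<in> X" "f False \<in> X" "f True \<noteq> f False"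
    by (auto dest: injD)
  then show thesis using that by blast
qed

text \<open>Removing a larger set leaves a smaller complement, also for infinite cardinals as long as the
  two removed sets are disjoint: both complements contain \<open>V - (A \<union> B)\<close>, and what remains is \<open>B\<close>
  in one and \<open>A\<close> in the other.\<close>

lemma card_of_Diff_antimono:
  assumes "B \<subseteq> V" "A \<subseteq> V" "A \<inter> B = {}" "|B| \<le>o |A|"
  shows "|V - A| \<le>o |V - B|"
proof -
  from assms(4) obtain f where f: "inj_on f B" "f ` B \<subseteq> A"
    unfolding card_of_ordLeq[symmetric] by blast
  define g where "g x = (if x \<in> B then f x else x)" for x
  have "inj_on g (V - A)"
    using f unfolding inj_on_def g_def by (auto simp: image_subset_iff)
  moreover have "g ` (V - A) \<subseteq> V - B"
    using f assms unfolding g_def by auto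
  ultimately show ?thesis
    unfolding card_of_ordLeq[symmetric] by blast
qed

section \<open>Joins of complete multipartite and complete graphs\<close>

text \<open>The parts \<open>C i\<close> need not cover the vertex set: a vertex outside all of them is adjacent to all
  other vertices.\<close>

locale partite_join =
  fixes G :: "'a pair_pre_digraph" and I :: "'i set" and C :: "'i \<Rightarrow> 'a set"
  assumes part_subset: "i \<in> I \<Longrightarrow> C i \<subseteq> pverts G"
    and part_nonempty: "i \<in> I \<Longrightarrow> C i \<noteq> {}"
    and part_unique: "i \<in> I \<Longrightarrow> j \<in> I \<Longrightarrow> x \<in> C i \<Longrightarrow> x \<in> C j \<Longrightarrow> i = j"
    and two_parts: "\<exists>i\<in>I. \<exists>j\<in>I. i \<noteq> j"
    and adjacent_iff: "(x, y) \<in> parcs G \<longleftrightarrow>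
      x \<in> pverts G \<and> y \<in> pverts G \<and> x \<noteq> y \<and> \<not> (\<exists>i\<in>I. x \<in> C i \<and> y \<in> C i)"
begin

lemma neighbours_in_part:
  assumes "i \<in> I" "v \<in> C i"
  shows "neighbours G v = pverts G - C i"
proof -
  have "(\<exists>j\<in>I. v \<in> C j \<and> u \<in> C j) \<longleftrightarrow> u \<in> C i" for u
    using assms part_unique by blast
  then show ?thesis
    using assms part_subset unfolding neighbours_def adjacent_iff by auto
qed

lemma neighbours_outside_parts:
  assumes "v \<in> pverts G" "\<And>i. i \<in> I \<Longrightarrow> v \<notin> C i"
  shows "neighbours G v = pverts G - {v}"
  using assms unfolding neighbours_def adjacent_iff by auto

lemma connected: "Digraph_Component.connected (with_proj G)"
proof -
  interpret pair_wf_digraph G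
    by unfold_locales (auto simp: adjacent_iff)
  have "u \<rightarrow>\<^sup>*\<^bsub>with_proj G\<^esub> v" if uv: "u \<in> pverts G" "v \<in> pverts G" for u v
  proof (cases "\<exists>i\<in>I. u \<in> C i \<and> v \<in> C i")
    case True
    then obtain i where i: "i \<in> I" "u \<in> C i" "v \<in> C i" by blast
    \<comment> \<open>a vertex of another part is a common neighbour\<close>
    from two_parts i(1) obtain j where j: "j \<in> I" "j \<noteq> i" by metis
    with part_nonempty obtain w where w: "w \<in> C j" by blast
    have "w \<in> pverts G" "w \<notin> C i" using w j part_subset part_unique[OF i(1) j(1)] by auto
    then have "w \<in> neighbours G u" "w \<in> neighbours G v" using i neighbours_in_part by auto
    then have "(u, w) \<in> parcs G" "(w, v) \<in> parcs G"
      unfolding neighbours_def adjacent_iff by auto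
    then show ?thesis by (meson reachable_adjI reachable_trans)
  next
    case False
    show ?thesis
    proof (cases "u = v")
      case True
      then show ?thesis using uv by simp
    next
      case neq: False
      then have "(u, v) \<in> parcs G" using False uv unfolding adjacent_iff by blast
      then show ?thesis by (rule reachable_adjI)
    qed
  qed
  moreover have "pverts G \<noteq> {}" using two_parts part_nonempty part_subset by blast
  ultimately have "strongly_connected (with_proj G)"
    by (auto simp: strongly_connected_def)
  then show ?thesis
    unfolding Digraph_Component.connected_def strongly_connected_def
    by (auto intro: reachable_mk_symmetricI)
qed

text \<open>Adjacent vertices are never separated, so separated vertices belong to one part; a path through
  a common neighbour outside \<open>A\<close> would avoid \<open>A\<close>.  Conversely, a path that leaves a vertex of a part
  continues outside this part at once.\<close>

lemma separates_iff:
  "separates G A \<longleftrightarrow>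
    (\<exists>i\<in>I. pverts G - C i \<subseteq> A \<and> (\<exists>x\<in>C i - A. \<exists>y\<in>C i - A. x \<noteq> y))"
proof
  assume "separates G A"
  then obtain x y where x: "x \<in> pverts G" "x \<notin> A" and y: "y \<in> pverts G" "y \<notin> A" and "x \<noteq> y"
    and sep: "\<And>q. \<lbrakk>vpath q (with_proj G); hd q = x; last q = y\<rbrakk> \<Longrightarrow> set q \<inter> A \<noteq> {}"
    unfolding separates_def by blast
  have "(x, y) \<notin> parcs G"
  proof
    assume "(x, y) \<in> parcs G"
    then have "vpath [x, y] (with_proj G)"
      using x y \<open>x \<noteq> y\<close> by (auto simp: vpath_def vwalk_def)
    from sep[OF this] show False using x y by simp
  qed
  then obtain i where i: "i \<in> I" "x \<in> C i" "y \<in> C i"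
    using x y \<open>x \<noteq> y\<close> unfolding adjacent_iff by blast
  have "z \<in> A" if z: "z \<in> pverts G" "z \<notin> C i" for z
  proof (rule ccontr)
    assume "z \<notin> A"
    have "z \<in> neighbours G x" "z \<in> neighbours G y" using z i neighbours_in_part by auto
    then have "(x, z) \<in> parcs G" "(z, y) \<in> parcs G"
      unfolding neighbours_def adjacent_iff by auto
    moreover have "x \<noteq> z" "z \<noteq> y" using z i by auto
    ultimately have "vpath [x, z, y] (with_proj G)"
      using x y z \<open>x \<noteq> y\<close> by (auto simp: vpath_def vwalk_def)
    from sep[OF this] show False using x y \<open>z \<notin> A\<close> by simp
  qed
  then show "\<exists>i\<in>I. pverts G - C i \<subseteq> A \<and> (\<exists>x\<in>C i - A. \<exists>y\<in>C i - A. x \<noteq> y)"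
    using i x y \<open>x \<noteq> y\<close> by blast
next
  assume "\<exists>i\<in>I. pverts G - C i \<subseteq> A \<and> (\<exists>x\<in>C i - A. \<exists>y\<in>C i - A. x \<noteq> y)"
  then obtain i x y where i: "i \<in> I" "pverts G - C i \<subseteq> A"
    and xy: "x \<in> C i - A" "y \<in> C i - A" "x \<noteq> y" by blast
  have "set q \<inter> A \<noteq> {}" if q: "vpath q (with_proj G)" "hd q = x" "last q = y" for q
  proof -
    obtain z r where q_eq: "q = x # z # r"
    proof (cases q rule: vwalk_arcs.cases)
      case 1
      then show thesis using q by (simp add: vpath_def vwalk_def)
    next
      case (2 a)
      then show thesis using q xy by simp
    next
      case (3 a b s)
      then show thesis using q that by simp
    qed
    then have "(x, z) \<in> parcs G" using q by (auto simp: vpath_def vwalk_def)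
    then have "z \<in> pverts G - C i" using i xy unfolding adjacent_iff by blast
    then show ?thesis using i q_eq by auto
  qed
  then show "separates G A"
    unfolding separates_def using i xy part_subset by blast
qed

lemma cut_set_iff:
  "cut_set G A \<longleftrightarrow> (\<exists>i\<in>I. A = pverts G - C i \<and> (\<exists>x\<in>C i. \<exists>y\<in>C i. x \<noteq> y))"
proof
  assume A: "cut_set G A"
  then have "separates G A" by (simp add: cut_set_def)
  then obtain i where i: "i \<in> I" "pverts G - C i \<subseteq> A" and xy: "\<exists>x\<in>C i. \<exists>y\<in>C i. x \<noteq> y"
    unfolding separates_iff by blast
  then have "separates G (pverts G - C i)" unfolding separates_iff by blast
  then have "\<not> pverts G - C i \<subset> A" using A unfolding cut_set_def by blast
  then show "\<exists>i\<in>I. A = pverts G - C i \<and> (\<exists>x\<in>C i. \<exists>y\<in>C i. x \<noteq> y)"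
    using i xy by blast
next
  assume "\<exists>i\<in>I. A = pverts G - C i \<and> (\<exists>x\<in>C i. \<exists>y\<in>C i. x \<noteq> y)"
  then obtain i where i: "i \<in> I" "A = pverts G - C i" and xy: "\<exists>x\<in>C i. \<exists>y\<in>C i. x \<noteq> y"
    by blast
  then have "separates G A" unfolding separates_iff by blast
  moreover have "\<not> separates G B" if "B \<subset> A" for B
  proof
    assume "separates G B"
    then obtain j where j: "j \<in> I" "pverts G - C j \<subseteq> B" unfolding separates_iff by blast
    \<comment> \<open>the part \<open>C j\<close> contains the nonempty part \<open>C i\<close>, so it is the same part\<close>
    then have "C i \<subseteq> C j" using that i part_subset by blast
    then have "i = j" using part_nonempty part_unique i j by blast
    then show False using that i j by blast
  qed
  ultimately show "cut_set G A"
    unfolding cut_set_def using connected i by blast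
qed

lemma minimum_cut_set_largest_part:
  assumes "i \<in> I" "x \<in> C i" "y \<in> C i" "x \<noteq> y"
    and largest: "\<And>j. j \<in> I \<Longrightarrow> |C j| \<le>o |C i|"
  shows "minimum_cut_set G (pverts G - C i)"
  unfolding minimum_cut_set_def
proof (intro conjI allI impI)
  show "cut_set G (pverts G - C i)" unfolding cut_set_iff using assms by blast
next
  fix B assume "cut_set G B"
  then obtain j where j: "j \<in> I" "B = pverts G - C j" unfolding cut_set_iff by blast
  show "|pverts G - C i| \<le>o |B|"
  proof (cases "i = j")
    case True
    then show ?thesis using j by (simp add: card_of_mono1)
  next
    case False
    then have "C i \<inter> C j = {}" using assms(1) j(1) part_unique by blast
    then show ?thesis
      unfolding j(2) using assms(1) j(1) part_subset largest
      by (intro card_of_Diff_antimono) auto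
  qed
qed

text \<open>A vertex of a part misses exactly this part.  A vertex outside all parts misses only itself,
  which is no more than what a vertex of the nonempty part \<open>C i\<close> misses.\<close>

lemma min_degree_largest_part:
  assumes fin: "finite (pverts G)" and i: "i \<in> I"
    and largest: "\<And>j. j \<in> I \<Longrightarrow> card (C j) \<le> card (C i)"
  shows "nat_of_cardinal (min_degree G) = card (pverts G) - card (C i)"
proof -
  have card_compl: "card (pverts G - C j) = card (pverts G) - card (C j)" if "j \<in> I" for j
    using that part_subset fin by (meson card_Diff_subset finite_subset)
  obtain v where v: "v \<in> C i" using i part_nonempty by blast
  then have v': "v \<in> pverts G" using i part_subset by blast
  have "card (C i) \<ge> 1"
    using v i part_subset fin by (metis One_nat_def Suc_leI card_gt_0_iff empty_iff finite_subset)
  have le: "card (pverts G) - card (C i) \<le> card (neighbours G u)" if u: "u \<in> pverts G" for u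
  proof (cases "\<exists>j\<in>I. u \<in> C j")
    case True
    then obtain j where j: "j \<in> I" "u \<in> C j" by blast
    then show ?thesis
      using largest[OF j(1)] by (simp add: neighbours_in_part card_compl)
  next
    case False
    then have "card (neighbours G u) = card (pverts G) - 1"
      using u fin by (simp add: neighbours_outside_parts)
    then show ?thesis using \<open>card (C i) \<ge> 1\<close> by simp
  qed
  have "nat_of_cardinal (min_degree G) = Min (card ` neighbours G ` pverts G)"
    unfolding min_degree_def using fin v'
    by (intro nat_of_min_cardinal) (auto simp: neighbours_def)
  also have "\<dots> = card (pverts G) - card (C i)"
  proof (rule Min_eqI)
    show "finite (card ` neighbours G ` pverts G)" using fin by simp
    show "card (pverts G) - card (C i) \<le> k" if "k \<in> card ` neighbours G ` pverts G" for k
      using that le by auto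
    have "card (neighbours G v) = card (pverts G) - card (C i)"
      using neighbours_in_part[OF i v] card_compl[OF i] by simp
    then show "card (pverts G) - card (C i) \<in> card ` neighbours G ` pverts G"
      using v' by force
  qed
  finally show ?thesis .
qed

end

lemma vertex_connectivity_eq_card:
  assumes "minimum_cut_set G A" "finite A"
  shows "nat_of_cardinal (vertex_connectivity G) = card A"
proof -
  define B where "B = (SOME A. minimum_cut_set G A)"
  have B: "minimum_cut_set G B" unfolding B_def by (rule someI[of _ A]) fact
  then have "|B| \<le>o |A|" "|A| \<le>o |B|" using assms(1) by (auto simp: minimum_cut_set_def)
  moreover from this(1) have "finite B" using assms(2) by (rule card_of_ordLeq_finite)
  ultimately have "card B = card A" using assms(2) by (simp add: finite_card_of_ordLeq)
  then show ?thesis by (simp add: vertex_connectivity_def B_def)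
qed

section \<open>Minimal primes of a reduced ring\<close>

\<comment> \<open>from here on \<open>\<oplus>\<close> is the addition of a ring\<close>
no_notation vwalk_join (infixr \<open>\<oplus>\<close> 65)

locale reduced_cring = cring R for R (structure) +
  assumes reduced: "reduced R"
begin

lemma nilpotent_zero: "x \<in> carrier R \<Longrightarrow> x [^] (k::nat) = \<zero> \<Longrightarrow> x = \<zero>"
  using reduced by (auto simp: reduced_def)

text \<open>If \<open>s a\<^sup>k = 0\<close> then \<open>s a\<close> is nilpotent: \<open>(s a)\<^sup>k\<^sup>+\<^sup>1\<close> is a multiple of \<open>s a\<^sup>k\<close>.\<close>

lemma mult_pow_zero:
  assumes "s \<in> carrier R" "a \<in> carrier R" "s \<otimes> a [^] (k::nat) = \<zero>"
  shows "s \<otimes> a = \<zero>"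
proof (rule nilpotent_zero[of _ "Suc k"])
  have "(s \<otimes> a) [^] Suc k = (s [^] k \<otimes> a) \<otimes> (s \<otimes> a [^] k)"
    using assms(1,2) by (simp add: nat_pow_distrib m_ac)
  then show "(s \<otimes> a) [^] Suc k = \<zero>" using assms by simp
qed (use assms in auto)

definition avoiding_monoid :: "'a set \<Rightarrow> bool" where
  "avoiding_monoid M \<longleftrightarrow> M \<subseteq> carrier R \<and> \<one> \<in> M \<and> \<zero> \<notin> M \<and> (\<forall>a\<in>M. \<forall>b\<in>M. a \<otimes> b \<in> M)"

text \<open>A maximal multiplicative set without zero is the complement of a minimal prime.  The point is
  that its complement \<open>P\<close> consists exactly of the elements that are annihilated by some element of
  \<open>M\<close>: adjoining the powers of an element \<open>a \<in> P\<close> to \<open>M\<close> must produce zero, and since \<open>R\<close> is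
  reduced the first power of \<open>a\<close> already does.  From this description it is immediate that \<open>P\<close> is
  an ideal, and that every prime inside \<open>P\<close> contains \<open>P\<close>.\<close>

lemma minimal_prime_of_maximal_monoid:
  assumes M: "avoiding_monoid M"
    and max: "\<And>N. avoiding_monoid N \<Longrightarrow> M \<subseteq> N \<Longrightarrow> N = M"
  shows "carrier R - M \<in> minimal_primes R"
proof -
  have M_sub: "M \<subseteq> carrier R" and M_one: "\<one> \<in> M" and M_zero: "\<zero> \<notin> M"
    and M_mult: "\<And>a b. a \<in> M \<Longrightarrow> b \<in> M \<Longrightarrow> a \<otimes> b \<in> M"
    using M by (auto simp: avoiding_monoid_def)
  have compl_iff: "a \<notin> M \<longleftrightarrow> (\<exists>s\<in>M. s \<otimes> a = \<zero>)" if a: "a \<in> carrier R" for a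
  proof
    assume "a \<notin> M"
    define N where "N = {s \<otimes> a [^] k | s (k::nat). s \<in> M}"
    have "s \<otimes> a [^] (0::nat) = s" if "s \<in> M" for s
      using that M_sub by auto
    then have "M \<subseteq> N" unfolding N_def by (smt (verit) mem_Collect_eq subsetI)
    moreover have "a \<in> N"
    proof -
      have "\<one> \<otimes> a [^] (1::nat) = a" using a by simp
      then show ?thesis unfolding N_def using M_one by (smt (verit) mem_Collect_eq)
    qed
    ultimately have "\<not> avoiding_monoid N" using max \<open>a \<notin> M\<close> by blast
    moreover have "u \<otimes> v \<in> N" if uv: "u \<in> N" "v \<in> N" for u v
    proof -
      obtain s t and k l :: nat where
        st: "s \<in> M" "t \<in> M" "u = s \<otimes> a [^] k" "v = t \<otimes> a [^] l"
        using uv unfolding N_def by blast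
      moreover from st(1,2) have "s \<in> carrier R" "t \<in> carrier R" using M_sub by auto
      ultimately have "u \<otimes> v = (s \<otimes> t) \<otimes> a [^] (k + l)"
        using a by (simp add: nat_pow_mult[symmetric] m_ac)
      then show ?thesis unfolding N_def using M_mult st(1,2) by blast
    qed
    moreover have "N \<subseteq> carrier R" using a M_sub unfolding N_def by auto
    ultimately have "\<zero> \<in> N"
      unfolding avoiding_monoid_def using \<open>M \<subseteq> N\<close> M_one by blast
    then obtain s and k :: nat where s: "s \<in> M" "\<zero> = s \<otimes> a [^] k" unfolding N_def by blast
    then have "s \<otimes> a = \<zero>" using a M_sub mult_pow_zero by (metis subsetD)
    then show "\<exists>s\<in>M. s \<otimes> a = \<zero>" using s by blast
  next
    assume "\<exists>s\<in>M. s \<otimes> a = \<zero>"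
    then show "a \<notin> M" using M_mult M_zero by metis
  qed
  define P where "P = carrier R - M"
  have P_iff: "a \<in> P \<longleftrightarrow> a \<in> carrier R \<and> (\<exists>s\<in>M. s \<otimes> a = \<zero>)" for a
    unfolding P_def using compl_iff by blast
  have P_mult: "x \<otimes> a \<in> P" if a: "a \<in> P" and x: "x \<in> carrier R" for a x
  proof -
    obtain s where s: "s \<in> M" "s \<otimes> a = \<zero>" using a P_iff by blast
    have "s \<otimes> (x \<otimes> a) = x \<otimes> (s \<otimes> a)" using s a x M_sub P_iff m_lcomm by blast
    then show ?thesis using s a x P_iff by auto
  qed
  have P_add: "a \<oplus> b \<in> P" if ab: "a \<in> P" "b \<in> P" for a b
  proof -
    obtain s t where st: "s \<in> M" "s \<otimes> a = \<zero>" "t \<in> M" "t \<otimes> b = \<zero>" using ab P_iff by blast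
    have car: "s \<in> carrier R" "t \<in> carrier R" "a \<in> carrier R" "b \<in> carrier R"
      using st ab M_sub P_iff by auto
    then have "(s \<otimes> t) \<otimes> (a \<oplus> b) = t \<otimes> (s \<otimes> a) \<oplus> s \<otimes> (t \<otimes> b)"
      by (simp add: r_distr m_ac)
    then have "(s \<otimes> t) \<otimes> (a \<oplus> b) = \<zero>" using st car by simp
    then show ?thesis using car st M_mult P_iff by blast
  qed
  have P_zero: "\<zero> \<in> P" unfolding P_def using M_zero by simp
  have P_minus: "\<ominus> a \<in> P" if "a \<in> P" for a
  proof -
    have "a \<in> carrier R" using that P_iff by blast
    then have "\<ominus> a = (\<ominus> \<one>) \<otimes> a" by (simp add: l_minus)
    then show ?thesis using P_mult[OF that, of "\<ominus> \<one>"] by simp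
  qed
  have "subgroup P (add_monoid R)"
  proof
    show "P \<subseteq> carrier (add_monoid R)" using P_iff by auto
    show "x \<otimes>\<^bsub>add_monoid R\<^esub> y \<in> P" if "x \<in> P" "y \<in> P" for x y
      using that P_add by simp
    show "\<one>\<^bsub>add_monoid R\<^esub> \<in> P" using P_zero by simp
    show "inv\<^bsub>add_monoid R\<^esub> x \<in> P" if "x \<in> P" for x
      using P_minus[OF that] by (simp add: a_inv_def)
  qed
  then have "ideal P R"
    using P_mult m_comm P_iff by (intro idealI) (auto simp: ring_axioms)
  then have "primeideal P R"
  proof (rule primeidealI)
    show "cring R" by (rule is_cring)
    show "carrier R \<noteq> P" unfolding P_def using M_one by auto
    show "a \<in> P \<or> b \<in> P" if "a \<in> carrier R" "b \<in> carrier R" "a \<otimes> b \<in> P" for a b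
      using that M_mult unfolding P_def by blast
  qed
  moreover have "Q = P" if Q: "primeideal Q R" "Q \<subseteq> P" for Q
  proof -
    interpret Q: primeideal Q R by fact
    have "a \<in> Q" if a: "a \<in> P" for a
    proof -
      obtain s where s: "s \<in> M" "s \<otimes> a = \<zero>" using a P_iff by blast
      then have "s \<in> Q \<or> a \<in> Q"
        using a M_sub P_iff Q.zero_closed by (intro Q.I_prime) auto
      then show ?thesis using s(1) Q(2) unfolding P_def by blast
    qed
    then show ?thesis using Q(2) by blast
  qed
  ultimately show ?thesis unfolding minimal_primes_def P_def by blast
qed

text \<open>The minimal primes intersect in zero: Zorn's lemma extends the powers of \<open>x\<close>, which avoid zero,
  to a maximal multiplicative set that avoids zero.\<close>

lemma ex_minimal_prime_avoiding:
  assumes x: "x \<in> carrier R" "x \<noteq> \<zero>"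
  obtains P where "P \<in> minimal_primes R" "x \<notin> P"
proof -
  define F where "F = {M. avoiding_monoid M \<and> x \<in> M}"
  have "range (\<lambda>k::nat. x [^] k) \<in> F"
  proof -
    have "x [^] (1::nat) \<in> range (\<lambda>k::nat. x [^] k)" "x [^] (0::nat) \<in> range (\<lambda>k::nat. x [^] k)"
      by (rule rangeI)+
    moreover have "x [^] k \<otimes> x [^] l \<in> range (\<lambda>k::nat. x [^] k)" for k l :: nat
      using x by (simp add: nat_pow_mult)
    moreover have "\<zero> \<noteq> x [^] k" for k :: nat using nilpotent_zero[OF x(1)] x(2) by metis
    ultimately show ?thesis unfolding F_def avoiding_monoid_def using x by auto
  qed
  then have "F \<noteq> {}" by blast
  then have "\<exists>M\<in>F. \<forall>N\<in>F. M \<subseteq> N \<longrightarrow> N = M"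
  proof (rule subset_Zorn_nonempty)
    fix \<C> assume ne: "\<C> \<noteq> {}" and chain: "subset.chain F \<C>"
    have mem: "avoiding_monoid M" "x \<in> M" if "M \<in> \<C>" for M
      using chain that unfolding subset.chain_def F_def by auto
    have "a \<otimes> b \<in> \<Union>\<C>" if ab: "a \<in> \<Union>\<C>" "b \<in> \<Union>\<C>" for a b
    proof -
      obtain M N where MN: "M \<in> \<C>" "a \<in> M" "N \<in> \<C>" "b \<in> N" using ab by blast
      then have "M \<subseteq> N \<or> N \<subseteq> M" using chain unfolding subset_chain_def by blast
      then obtain K where "K \<in> \<C>" "a \<in> K" "b \<in> K" using MN by blast
      then show ?thesis using mem(1)[of K] unfolding avoiding_monoid_def by blast
    qed
    then show "\<Union>\<C> \<in> F"
      using ne mem unfolding F_def avoiding_monoid_def by blast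
  qed
  then obtain M where M: "M \<in> F" and max: "\<And>N. N \<in> F \<Longrightarrow> M \<subseteq> N \<Longrightarrow> N = M" by blast
  have "carrier R - M \<in> minimal_primes R"
  proof (rule minimal_prime_of_maximal_monoid)
    show "avoiding_monoid M" using M by (simp add: F_def)
    show "N = M" if "avoiding_monoid N" "M \<subseteq> N" for N
      using that M max by (auto simp: F_def)
  qed
  moreover have "x \<notin> carrier R - M" using M by (simp add: F_def)
  ultimately show thesis by (rule that)
qed

end

section \<open>Adjacency in terms of minimal primes\<close>

locale enumerated_minimal_primes = reduced_cring R for R (structure) +
  fixes p :: "nat \<Rightarrow> 'a set" and n :: nat
  assumes enum: "bij_betw p {1..n} (minimal_primes R)"
begin

lemma prime_p: "i \<in> {1..n} \<Longrightarrow> primeideal (p i) R"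
  using bij_betwE[OF enum] by (auto simp: minimal_primes_def)

lemma p_subset: "i \<in> {1..n} \<Longrightarrow> p i \<subseteq> carrier R"
  using prime_p by (meson additive_subgroup.a_subset ideal.axioms(1) primeideal.axioms(1))

lemma mult_mem_p_iff:
  assumes "i \<in> {1..n}" "a \<in> carrier R" "b \<in> carrier R"
  shows "a \<otimes> b \<in> p i \<longleftrightarrow> a \<in> p i \<or> b \<in> p i"
proof -
  interpret primeideal "p i" R using assms(1) by (rule prime_p)
  show ?thesis
    using I_prime[OF assms(2,3)] I_l_closed[OF _ assms(2)] I_r_closed[OF _ assms(3)] by auto
qed

lemma zero_mem_p: "i \<in> {1..n} \<Longrightarrow> \<zero> \<in> p i"
  using prime_p by (meson additive_subgroup.zero_closed ideal.axioms(1) primeideal.axioms(1))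

lemma one_notin_p:
  assumes "i \<in> {1..n}"
  shows "\<one> \<notin> p i"
proof -
  interpret primeideal "p i" R using assms by (rule prime_p)
  show ?thesis using I_notcarr one_imp_carrier by auto
qed

lemma add_mem_p_iff:
  assumes "i \<in> {1..n}" "a \<in> p i" "b \<in> carrier R"
  shows "a \<oplus> b \<in> p i \<longleftrightarrow> b \<in> p i"
proof -
  interpret primeideal "p i" R using assms(1) by (rule prime_p)
  show ?thesis
  proof
    assume "a \<oplus> b \<in> p i"
    then have "\<ominus> a \<oplus> (a \<oplus> b) \<in> p i" using a_closed a_inv_closed assms(2) by blast
    then show "b \<in> p i" using assms(2,3) by (simp add: r_neg1)
  qed (use a_closed assms(2) in blast)
qed

lemma p_incomparable:
  assumes "i \<in> {1..n}" "j \<in> {1..n}" "i \<noteq> j"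
  shows "\<not> p j \<subseteq> p i"
proof
  assume "p j \<subseteq> p i"
  moreover have "p i \<in> minimal_primes R" "primeideal (p j) R"
    using assms prime_p bij_betwE[OF enum] by auto
  ultimately have "p j = p i" by (auto simp: minimal_primes_def)
  then show False using assms bij_betw_imp_inj_on[OF enum] by (auto dest: inj_onD)
qed

lemma in_all_minimal_primes_iff:
  assumes "x \<in> carrier R"
  shows "(\<forall>i\<in>{1..n}. x \<in> p i) \<longleftrightarrow> x = \<zero>"
proof
  assume all: "\<forall>i\<in>{1..n}. x \<in> p i"
  show "x = \<zero>"
  proof (rule ccontr)
    assume "x \<noteq> \<zero>"
    with assms obtain P where "P \<in> minimal_primes R" "x \<notin> P" by (rule ex_minimal_prime_avoiding)
    then show False using all bij_betw_imp_surj_on[OF enum] by blast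
  qed
qed (simp add: zero_mem_p)

text \<open>The product of elements \<open>a\<^sub>j \<in> p j - p i\<close>, one for each \<open>j \<noteq> i\<close>.\<close>

lemma ex_outside_exactly_one:
  assumes i: "i \<in> {1..n}"
  obtains e where "e \<in> carrier R" "e \<notin> p i" "\<And>j. j \<in> {1..n} \<Longrightarrow> j \<noteq> i \<Longrightarrow> e \<in> p j"
proof -
  have "\<exists>e\<in>carrier R. e \<notin> p i \<and> (\<forall>j\<in>J. e \<in> p j)" if "finite J" "J \<subseteq> {1..n} - {i}" for J
    using that
  proof (induction J rule: finite_induct)
    case empty
    then show ?case using one_notin_p[OF i] by auto
  next
    case (insert j J)
    then obtain e where e: "e \<in> carrier R" "e \<notin> p i" "\<forall>j\<in>J. e \<in> p j" by auto
    have j: "j \<in> {1..n}" "j \<noteq> i" using insert.prems by auto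
    then obtain a where a: "a \<in> p j" "a \<notin> p i" using p_incomparable[OF i, of j] by blast
    have "a \<in> carrier R" using a j p_subset by blast
    then have "a \<otimes> e \<in> carrier R" "a \<otimes> e \<notin> p i" "\<forall>k\<in>insert j J. a \<otimes> e \<in> p k"
      using e a j i insert.prems by (auto simp: mult_mem_p_iff)
    then show ?case by blast
  qed
  from this[of "{1..n} - {i}"] show thesis using that by auto
qed

text \<open>Every set \<open>J\<close> of indices is the set of minimal primes that avoid some element: summing the
  elements of the preceding lemma over \<open>J\<close>, exactly one summand lies outside \<open>p j\<close> for each
  \<open>j \<in> J\<close>.\<close>

lemma ex_outside_exactly:
  assumes "J \<subseteq> {1..n}"
  shows "\<exists>x\<in>carrier R. \<forall>k\<in>{1..n}. x \<in> p k \<longleftrightarrow> k \<notin> J"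
proof -
  have "finite J" using assms finite_subset by blast
  then show ?thesis using assms
  proof (induction J rule: finite_induct)
    case empty
    show ?case using zero_mem_p by (intro bexI[of _ \<zero>]) auto
  next
    case (insert j J)
    then obtain x where x: "x \<in> carrier R" "\<And>k. k \<in> {1..n} \<Longrightarrow> x \<in> p k \<longleftrightarrow> k \<notin> J" by auto
    have j: "j \<in> {1..n}" using insert.prems by auto
    then obtain e where e: "e \<in> carrier R" "e \<notin> p j"
      "\<And>k. k \<in> {1..n} \<Longrightarrow> k \<noteq> j \<Longrightarrow> e \<in> p k" by (rule ex_outside_exactly_one) blast
    have "e \<oplus> x \<in> p k \<longleftrightarrow> k \<notin> insert j J" if k: "k \<in> {1..n}" for k
    proof (cases "k = j")
      case True
      then have "x \<in> p k" using x(2)[OF k] insert.hyps by simp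
      then have "x \<oplus> e \<in> p k \<longleftrightarrow> e \<in> p k" using add_mem_p_iff k e(1) by blast
      then show ?thesis using True e(2) a_comm[OF e(1) x(1)] by simp
    next
      case False
      then have "e \<oplus> x \<in> p k \<longleftrightarrow> x \<in> p k" using add_mem_p_iff k e(3) x(1) by blast
      then show ?thesis using x(2)[OF k] False by simp
    qed
    then show ?case using e(1) x(1) by blast
  qed
qed

lemma mem_gamma_iff: "x \<in> gamma p n i \<longleftrightarrow> x \<in> p i \<and> (\<forall>j\<in>{1..n}. x \<in> p j \<longrightarrow> j = i)"
  unfolding gamma_def by blast

lemma gamma_nonempty:
  assumes "i \<in> {1..n}"
  shows "gamma p n i \<noteq> {}"
proof -
  obtain x where "\<And>k. k \<in> {1..n} \<Longrightarrow> x \<in> p k \<longleftrightarrow> k \<notin> {1..n} - {i}"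
    using ex_outside_exactly[of "{1..n} - {i}"] by blast
  then have "x \<in> gamma p n i" using assms by (auto simp: mem_gamma_iff)
  then show ?thesis by blast
qed

lemma zero_divisor_iff:
  assumes x: "x \<in> carrier R"
  shows "x \<in> zero_divisors R \<longleftrightarrow> (\<exists>i\<in>{1..n}. x \<in> p i)"
proof
  assume "x \<in> zero_divisors R"
  then obtain y where y: "y \<in> carrier R" "y \<noteq> \<zero>" "x \<otimes> y = \<zero>"
    unfolding zero_divisors_def by blast
  then obtain i where i: "i \<in> {1..n}" "y \<notin> p i" using in_all_minimal_primes_iff by blast
  then have "x \<in> p i" using mult_mem_p_iff[OF i(1) x y(1)] y(3) zero_mem_p by simp
  then show "\<exists>i\<in>{1..n}. x \<in> p i" using i by blast
next
  assume "\<exists>i\<in>{1..n}. x \<in> p i"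
  then obtain i where i: "i \<in> {1..n}" "x \<in> p i" by blast
  then obtain e where e: "e \<in> carrier R" "e \<notin> p i"
    "\<And>j. j \<in> {1..n} \<Longrightarrow> j \<noteq> i \<Longrightarrow> e \<in> p j" using ex_outside_exactly_one by blast
  have "x \<otimes> e \<in> p j" if "j \<in> {1..n}" for j
    using that i e x by (cases "j = i") (auto simp: mult_mem_p_iff)
  then have "x \<otimes> e = \<zero>" using x e(1) by (simp flip: in_all_minimal_primes_iff)
  moreover have "e \<noteq> \<zero>" using e(2) i(1) zero_mem_p by blast
  ultimately show "x \<in> zero_divisors R" unfolding zero_divisors_def using x e(1) by blast
qed

lemma vertex_iff:
  "x \<in> nonzero_zero_divisors R \<longleftrightarrow> x \<in> carrier R \<and> x \<noteq> \<zero> \<and> (\<exists>i\<in>{1..n}. x \<in> p i)"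
proof -
  have "x \<in> zero_divisors R \<Longrightarrow> x \<in> carrier R" by (simp add: zero_divisors_def)
  then show ?thesis unfolding nonzero_zero_divisors_def using zero_divisor_iff by blast
qed

lemma ann_mem_p:
  assumes "i \<in> {1..n}" "x \<in> carrier R" "x \<notin> p i" "w \<in> ann R x"
  shows "w \<in> p i"
  using assms mult_mem_p_iff[of i w x] zero_mem_p by (auto simp: ann_def)

text \<open>An element of \<open>ann R x\<close> lies in every minimal prime that avoids \<open>x\<close>.  If \<open>x \<in> \<gamma>\<^sub>i\<close>, this leaves
  only \<open>p i\<close> to avoid a nonzero annihilator.\<close>

lemma ann_outside_p:
  assumes "i \<in> {1..n}" "x \<in> gamma p n i" "w \<in> ann R x" "w \<noteq> \<zero>"
  shows "w \<notin> p i"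
proof
  assume "w \<in> p i"
  have "x \<in> carrier R" using assms(1,2) p_subset mem_gamma_iff by blast
  moreover have "w \<in> carrier R" using assms(3) by (simp add: ann_def)
  moreover have "w \<in> p j" if "j \<in> {1..n}" for j
    using that \<open>w \<in> p i\<close> assms \<open>x \<in> carrier R\<close> ann_mem_p mem_gamma_iff by metis
  ultimately show False using assms(4) in_all_minimal_primes_iff by blast
qed

lemma orthogonal_annihilators:
  assumes i: "i \<in> {1..n}" "x \<in> p i" and j: "j \<in> {1..n}" "y \<in> p j" and "i \<noteq> j"
  shows "\<exists>w\<in>ann R x - {\<zero>}. \<exists>z\<in>ann R y - {\<zero>}. w \<otimes> z = \<zero>"
proof -
  have car: "x \<in> carrier R" "y \<in> carrier R" using i j p_subset by blast+
  obtain w where w: "w \<in> carrier R" "w \<notin> p i"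
    "\<And>k. k \<in> {1..n} \<Longrightarrow> k \<noteq> i \<Longrightarrow> w \<in> p k" using i(1) by (rule ex_outside_exactly_one) blast
  obtain z where z: "z \<in> carrier R" "z \<notin> p j"
    "\<And>k. k \<in> {1..n} \<Longrightarrow> k \<noteq> j \<Longrightarrow> z \<in> p k" using j(1) by (rule ex_outside_exactly_one) blast
  have "\<forall>k\<in>{1..n}. w \<otimes> x \<in> p k" "\<forall>k\<in>{1..n}. z \<otimes> y \<in> p k" "\<forall>k\<in>{1..n}. w \<otimes> z \<in> p k"
    using w z i j car \<open>i \<noteq> j\<close> by (metis mult_mem_p_iff)+
  then have "w \<otimes> x = \<zero>" "z \<otimes> y = \<zero>" "w \<otimes> z = \<zero>"
    using w(1) z(1) car in_all_minimal_primes_iff[THEN iffD1, OF m_closed] by blast+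
  moreover have "w \<noteq> \<zero>" "z \<noteq> \<zero>" using w(2) z(2) i(1) j(1) zero_mem_p by blast+
  ultimately show ?thesis using w(1) z(1) by (auto simp: ann_def)
qed

lemma WGamma_adjacent_iff:
  "(x, y) \<in> parcs (WGamma R) \<longleftrightarrow>
    x \<in> nonzero_zero_divisors R \<and> y \<in> nonzero_zero_divisors R \<and> x \<noteq> y \<and>
    \<not> (\<exists>i\<in>{1..n}. x \<in> gamma p n i \<and> y \<in> gamma p n i)"
proof -
  have "(\<exists>w\<in>ann R x - {\<zero>}. \<exists>z\<in>ann R y - {\<zero>}. w \<otimes> z = \<zero>) \<longleftrightarrow>
      \<not> (\<exists>i\<in>{1..n}. x \<in> gamma p n i \<and> y \<in> gamma p n i)" (is "?orth \<longleftrightarrow> \<not> ?same")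
    if xy: "x \<in> nonzero_zero_divisors R" "y \<in> nonzero_zero_divisors R"
  proof
    assume ?orth
    then obtain w z where wz: "w \<in> ann R x" "w \<noteq> \<zero>" "z \<in> ann R y" "z \<noteq> \<zero>" "w \<otimes> z = \<zero>"
      by blast
    show "\<not> ?same"
    proof
      assume ?same
      then obtain i where i: "i \<in> {1..n}" "x \<in> gamma p n i" "y \<in> gamma p n i" by blast
      then have "w \<notin> p i" "z \<notin> p i" using ann_outside_p wz by blast+
      moreover have "w \<in> carrier R" "z \<in> carrier R" using wz by (auto simp: ann_def)
      ultimately have "w \<otimes> z \<notin> p i" using i(1) mult_mem_p_iff by blast
      then show False using wz(5) i(1) zero_mem_p by simp
    qed
  next
    assume "\<not> ?same"
    obtain i j where ij: "i \<in> {1..n}" "x \<in> p i" "j \<in> {1..n}" "y \<in> p j"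
      using xy unfolding vertex_iff by blast
    show ?orth
    proof (cases "i = j")
      case False
      then show ?thesis using ij orthogonal_annihilators by blast
    next
      case True
      \<comment> \<open>one of the two elements then lies in a further minimal prime, which replaces \<open>p i\<close> for it\<close>
      then have "x \<notin> gamma p n i \<or> y \<notin> gamma p n i" using \<open>\<not> ?same\<close> ij by blast
      then consider k where "k \<in> {1..n}" "k \<noteq> i" "x \<in> p k" | k where "k \<in> {1..n}" "k \<noteq> i" "y \<in> p k"
        using ij True mem_gamma_iff by blast
      then show ?thesis
      proof cases
        case 1
        then show ?thesis using ij True orthogonal_annihilators by blast
      next
        case 2
        then show ?thesis using ij orthogonal_annihilators by blast
      qed
    qed
  qed
  then show ?thesis unfolding WGamma_def by auto
qed

lemma WGamma_partite_join:
  assumes "2 \<le> n"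
  shows "partite_join (WGamma R) {1..n} (gamma p n)"
proof
  have verts: "pverts (WGamma R) = nonzero_zero_divisors R" by (simp add: WGamma_def)
  show "gamma p n i \<subseteq> pverts (WGamma R)" if i: "i \<in> {1..n}" for i
  proof
    fix x assume x: "x \<in> gamma p n i"
    \<comment> \<open>zero lies in a second minimal prime\<close>
    define j :: nat where "j = (if i = 1 then 2 else 1)"
    then have j: "j \<in> {1..n}" "j \<noteq> i" using assms by auto
    then have "x \<noteq> \<zero>" using x mem_gamma_iff zero_mem_p by metis
    then show "x \<in> pverts (WGamma R)"
      using x i p_subset unfolding verts vertex_iff mem_gamma_iff by blast
  qed
  show "gamma p n i \<noteq> {}" if "i \<in> {1..n}" for i
    using that by (rule gamma_nonempty)
  show "i = j" if "i \<in> {1..n}" "j \<in> {1..n}" "x \<in> gamma p n i" "x \<in> gamma p n j" for i j x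
    using that mem_gamma_iff by blast
  have "1 \<in> {1..n}" "2 \<in> {1..n}" using assms by auto
  then show "\<exists>i\<in>{1..n}. \<exists>j\<in>{1..n}. i \<noteq> j" by (metis one_eq_numeral_iff semiring_norm(83))
  show "(x, y) \<in> parcs (WGamma R) \<longleftrightarrow> x \<in> pverts (WGamma R) \<and> y \<in> pverts (WGamma R) \<and> x \<noteq> y \<and>
      \<not> (\<exists>i\<in>{1..n}. x \<in> gamma p n i \<and> y \<in> gamma p n i)" for x y
    unfolding verts by (rule WGamma_adjacent_iff)
qed

end

section \<open>Minimum cut-sets and connectivity of the weakly zero-divisor graph\<close>

theorem theorem3p8:
  fixes R :: "('a, 'b) ring_scheme" and p :: "nat \<Rightarrow> 'a set" and n :: nat
  assumes "cring R" and "reduced R"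
    and "3 \<le> n" and "bij_betw p {1..n} (minimal_primes R)"
    and "ctwo \<le>o alpha_max p n"
  shows "(\<forall>i\<in>alpha_indices p n.
            minimum_cut_set (WGamma R) (nonzero_zero_divisors R - gamma p n i)) \<and>
         (finite (carrier R) \<longrightarrow>
            nat_of_cardinal (vertex_connectivity (WGamma R))
              = card (nonzero_zero_divisors R) - nat_of_cardinal (alpha_max p n) \<and>
            card (nonzero_zero_divisors R) - nat_of_cardinal (alpha_max p n)
              = nat_of_cardinal (min_degree (WGamma R)))"
proof -
  interpret enumerated_minimal_primes R p n
    by (intro enumerated_minimal_primes.intro reduced_cring.intro
        reduced_cring_axioms.intro enumerated_minimal_primes_axioms.intro assms(1,2,4))
  interpret W: partite_join "WGamma R" "{1..n}" "gamma p n"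
    using assms(3) by (intro WGamma_partite_join) simp
  have verts: "pverts (WGamma R) = nonzero_zero_divisors R" by (simp add: WGamma_def)
  have "finite (gamma p n ` {1..n})" "gamma p n ` {1..n} \<noteq> {}" using assms(3) by auto
  then obtain X where "X \<in> gamma p n ` {1..n}" "max_cardinal (gamma p n ` {1..n}) = |X|"
    "\<And>Y. Y \<in> gamma p n ` {1..n} \<Longrightarrow> |Y| \<le>o |X|" by (rule max_cardinal_attained) blast
  then obtain m where m: "m \<in> {1..n}" "alpha_max p n = |gamma p n m|"
    and largest: "\<And>j. j \<in> {1..n} \<Longrightarrow> |gamma p n j| \<le>o |gamma p n m|"
    unfolding alpha_max_def by blast
  have cut: "minimum_cut_set (WGamma R) (nonzero_zero_divisors R - gamma p n i)"
    if "i \<in> alpha_indices p n" for i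
  proof -
    have i: "i \<in> {1..n}" and "|gamma p n i| =o |gamma p n m|"
      using that m by (auto simp: alpha_indices_def)
    then have le: "|gamma p n m| \<le>o |gamma p n i|"
      by (simp add: ordIso_iff_ordLeq)
    then have "ctwo \<le>o |gamma p n i|"
      using assms(5) m(2) by (auto intro: ordLeq_transitive)
    then obtain x y where xy: "x \<in> gamma p n i" "y \<in> gamma p n i" "x \<noteq> y"
      by (rule ctwo_ordLeqE)
    show ?thesis
      unfolding verts[symmetric] using i xy
    proof (rule W.minimum_cut_set_largest_part)
      show "|gamma p n j| \<le>o |gamma p n i|" if "j \<in> {1..n}" for j
        using largest[OF that] le by (rule ordLeq_transitive)
    qed
  qed
  moreover have "nat_of_cardinal (vertex_connectivity (WGamma R))
        = card (nonzero_zero_divisors R) - nat_of_cardinal (alpha_max p n) \<and>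
      card (nonzero_zero_divisors R) - nat_of_cardinal (alpha_max p n)
        = nat_of_cardinal (min_degree (WGamma R))" if fin: "finite (carrier R)"
  proof -
    have finV: "finite (nonzero_zero_divisors R)"
      using fin by (rule rev_finite_subset) (use vertex_iff in blast)
    have fin_gamma: "finite (gamma p n j)" if "j \<in> {1..n}" for j
      using that finV W.part_subset verts by (metis finite_subset)
    have "m \<in> alpha_indices p n"
      using m by (simp add: alpha_indices_def card_of_refl)
    then have "nat_of_cardinal (vertex_connectivity (WGamma R))
        = card (nonzero_zero_divisors R - gamma p n m)"
      using cut finV by (intro vertex_connectivity_eq_card) auto
    also have "\<dots> = card (nonzero_zero_divisors R) - card (gamma p n m)"
      using W.part_subset[OF m(1)] fin_gamma[OF m(1)] verts by (simp add: card_Diff_subset)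
    finally have "nat_of_cardinal (vertex_connectivity (WGamma R))
        = card (nonzero_zero_divisors R) - card (gamma p n m)" .
    moreover have "nat_of_cardinal (min_degree (WGamma R))
        = card (nonzero_zero_divisors R) - card (gamma p n m)"
      unfolding verts[symmetric]
    proof (rule W.min_degree_largest_part)
      show "finite (pverts (WGamma R))" using finV verts by simp
      show "card (gamma p n j) \<le> card (gamma p n m)" if "j \<in> {1..n}" for j
        using largest[OF that] fin_gamma[OF that] fin_gamma[OF m(1)]
        by (simp add: finite_card_of_ordLeq)
    qed (rule m(1))
    ultimately show ?thesis using m(2) by simp
  qed
  ultimately show ?thesis by blast
qed

end
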